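(* Let $G$ be a locally compact Abelian group and let $\nu_0=\sum_{j=1}^n\nu_j$ be a sum of (nonnegative, locally finite) measures on $G$, all on a common sigma-algebra $\mathcal{S}$ of measurable sets. Then $\overline{D}(\nu_0)\le\sum_{j=1}^n\overline{D}(\nu_j)$. In particular, this holds for one given measure $\nu$ and a disjoint union $A_0=\bigcup_{j=1}^nA_j$ of measurable sets, with $\nu_j:=\nu|_{A_j}$ for $j=0,1,\dots,n$. If $\nu=\mu$ is the Haar measure, this gives $\overline{D}\big(\bigcup_{j=1}^nA_j\big)\le\sum_{j=1}^n\overline{D}(A_j)$.
   Context: $G$ is a locally compact (Hausdorff) Abelian group written additively, with a fixed Haar measure $\mu$. $\mathcal{B}_0$ denotes the family of all nonempty open subsets of $G$ with compact closure. A measure on $G$ with sigma-algebra $\mathcal{S}$ of measurable sets is locally finite if every measurable set contained in some compact set has finite measure. For a nonnegative, locally finite measure $\nu$ on $G$ with sigma-algebra $\mathcal{S}$, the asymptotic uniform upper density is $$\overline{D}(\nu):=\inf_{C}\ \sup_{V\in\mathcal{S}\cap\mathcal{B}_0}\frac{\nu(V)}{\mu(C+V)}\in[0,\infty],$$ where the infimum is over all nonempty compact $C\subset G$. $\nu|_A$ is the trace of $\nu$ on $A$, $\nu|_A(V)=\nu(A\cap V)$, and for Borel $A$, $\overline{D}(A):=\overline{D}(\mu|_A)$. *)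

theory Defs
  imports "HOL-Analysis.Analysis" "HOL-Library.Set_Algebras"
begin

definition haar_measure :: "'a::{topological_ab_group_add,t2_space} measure \<Rightarrow> bool" where
  "haar_measure \<mu> \<longleftrightarrow>
     sets \<mu> = sets borel \<and>
     emeasure \<mu> UNIV \<noteq> 0 \<and>
     (\<forall>x. \<forall>A\<in>sets borel. emeasure \<mu> ((+) x ` A) = emeasure \<mu> A) \<and>
     (\<forall>K. compact K \<longrightarrow> emeasure \<mu> K < \<infinity>) \<and>
     (\<forall>A\<in>sets borel. emeasure \<mu> A = (INF U\<in>{U. open U \<and> A \<subseteq> U}. emeasure \<mu> U)) \<and>
     (\<forall>U. open U \<longrightarrow> emeasure \<mu> U = (SUP K\<in>{K. compact K \<and> K \<subseteq> U}. emeasure \<mu> K))"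

definition bounded_opens :: "'a::topological_space set set" where
  "bounded_opens = {V. open V \<and> V \<noteq> {} \<and> compact (closure V)}"

definition locally_finite_measure :: "'a::topological_space measure \<Rightarrow> bool" where
  "locally_finite_measure \<nu> \<longleftrightarrow>
     (\<forall>K A. compact K \<longrightarrow> A \<in> sets \<nu> \<longrightarrow> A \<subseteq> K \<longrightarrow> emeasure \<nu> A < \<infinity>)"

text \<open>
  When \<open>\<mu>\<close> is a Haar measure, the denominators below are positive and finite, so the
  conventions for division by \<open>0\<close> and \<open>\<infinity>\<close> in \<open>ennreal\<close> play no role. The \<open>\<sigma>\<close>-algebra of
  \<open>\<nu>\<close> is not required to be related to the Borel sets.
\<close>

definition upper_density ::
    "'a::topological_ab_group_add measure \<Rightarrow> 'a measure \<Rightarrow> ennreal" where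
  "upper_density \<mu> \<nu> =
     (INF C\<in>{C. compact C \<and> C \<noteq> {}}.
        SUP V\<in>sets \<nu> \<inter> bounded_opens. emeasure \<nu> V / emeasure \<mu> (C + V))"

text \<open>
  Unlike \<open>restrict_space\<close>, the trace keeps the underlying space and the \<open>\<sigma>\<close>-algebra of \<open>\<nu>\<close>.
\<close>

definition trace_measure :: "'a measure \<Rightarrow> 'a set \<Rightarrow> 'a measure" where
  "trace_measure \<nu> A = measure_of (space \<nu>) (sets \<nu>) (\<lambda>V. emeasure \<nu> (A \<inter> V))"

lemma space_trace_measure [simp]: "space (trace_measure \<nu> A) = space \<nu>"
  by (simp add: trace_measure_def)

lemma sets_trace_measure [simp]: "sets (trace_measure \<nu> A) = sets \<nu>"
  by (simp add: trace_measure_def)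

lemma emeasure_trace_measure:
  assumes "A \<in> sets \<nu>" "V \<in> sets \<nu>"
  shows "emeasure (trace_measure \<nu> A) V = emeasure \<nu> (A \<inter> V)"
proof (rule emeasure_measure_of[OF trace_measure_def])
  show "sets \<nu> \<subseteq> Pow (space \<nu>)"
    by (rule sets.space_closed)
  show "V \<in> sets (trace_measure \<nu> A)"
    using assms(2) by simp
  show "positive (sets (trace_measure \<nu> A)) (\<lambda>V. emeasure \<nu> (A \<inter> V))"
    by (simp add: positive_def)
  show "countably_additive (sets (trace_measure \<nu> A)) (\<lambda>V. emeasure \<nu> (A \<inter> V))"
  proof (rule countably_additiveI)
    fix F :: "nat \<Rightarrow> 'a set"
    assume F: "range F \<subseteq> sets (trace_measure \<nu> A)" "disjoint_family F"
    have "range (\<lambda>i. A \<inter> F i) \<subseteq> sets \<nu>"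
      using F(1) assms(1) by (simp add: image_subset_iff sets.Int)
    moreover have "disjoint_family (\<lambda>i. A \<inter> F i)"
      using F(2) unfolding disjoint_family_on_def by blast
    ultimately have "(\<Sum>i. emeasure \<nu> (A \<inter> F i)) = emeasure \<nu> (\<Union>i. A \<inter> F i)"
      by (rule suminf_emeasure)
    then show "(\<Sum>i. emeasure \<nu> (A \<inter> F i)) = emeasure \<nu> (A \<inter> (\<Union>i. F i))"
      by (simp only: Int_UN_distrib)
  qed
qed

definition set_upper_density ::
    "'a::topological_ab_group_add measure \<Rightarrow> 'a set \<Rightarrow> ennreal" where
  "set_upper_density \<mu> A = upper_density \<mu> (trace_measure \<mu> A)"

end

theory Submission
  imports Defs
begin

text \<open>
  Enlarging the compact set \<open>C\<close> to \<open>C + C'\<close> does not decrease \<open>\<mu> (C + V)\<close>, because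
  \<open>C + C' + V\<close> contains a translate of \<open>C + V\<close>. Hence the suprema whose infima define the densities
  of the summands are directed downwards along one common family, and near-optimal compact sets
  for the individual summands can be replaced by their sum, which serves all of them at once.
\<close>

text \<open>Adding \<open>c\<close> is monotone and continuous from the right on
  \<open>ennreal\<close>, so it commutes with the infimum of a nonempty set.\<close>

lemma INF_add_const_ennreal:
  fixes f :: "'c \<Rightarrow> ennreal"
  assumes "X \<noteq> {}"
  shows "(INF x\<in>X. f x + c) = (INF x\<in>X. f x) + c"
  using continuous_at_Inf_mono[of "\<lambda>x. x + c" "f ` X"]
    continuous_add[of "at_right (Inf (f ` X))", of "\<lambda>x. x" "\<lambda>x. c"] assms
  by (auto simp: mono_def image_comp)

lemma INF_const_add_ennreal:
  fixes f :: "'c \<Rightarrow> ennreal"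
  assumes "X \<noteq> {}"
  shows "(INF x\<in>X. c + f x) = c + (INF x\<in>X. f x)"
  using INF_add_const_ennreal[OF assms, of f c] by (simp add: ac_simps)

lemma inverse_antimono_ennreal: "a \<le> b \<Longrightarrow> inverse b \<le> inverse (a::ennreal)"
  by (simp add: less_eq_ennreal.rep_eq inverse_ennreal.rep_eq ereal_inverse_antimono)

text \<open>In general only the reverse inequality holds, since different indices may need different
  near-minimizers. Downward directedness, uniform in \<open>i\<close>, supplies one element that is
  at least as good for every index.\<close>

lemma INF_sum_le_sum_INF_directed:
  fixes f :: "'i \<Rightarrow> 'c \<Rightarrow> ennreal"
  assumes "finite I" "X \<noteq> {}"
    and dir: "\<And>C C'. C \<in> X \<Longrightarrow> C' \<in> X \<Longrightarrow> \<exists>D\<in>X. \<forall>i\<in>I. f i D \<le> f i C \<and> f i D \<le> f i C'"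
  shows "(INF C\<in>X. \<Sum>i\<in>I. f i C) \<le> (\<Sum>i\<in>I. INF C\<in>X. f i C)"
  using assms(1) dir
proof (induction I rule: finite_induct)
  case empty
  then show ?case using assms(2) by simp
next
  case (insert i I)
  let ?g = "\<lambda>C. \<Sum>i\<in>I. f i C"
  \<comment> \<open>Decoupling: \<open>C\<close> is chosen for the new index and \<open>C'\<close>
    for the old ones, independently; a common lower bound \<open>D\<close> handles both.\<close>
  have le: "(INF C\<in>X. f i C + ?g C) \<le> f i C + ?g C'" if "C \<in> X" "C' \<in> X" for C C'
  proof -
    obtain D where D: "D \<in> X" "\<forall>k\<in>insert i I. f k D \<le> f k C \<and> f k D \<le> f k C'"
      using insert.prems \<open>C \<in> X\<close> \<open>C' \<in> X\<close> by blast
    then have "f i D + ?g D \<le> f i C + ?g C'"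
      by (intro add_mono sum_mono) auto
    with \<open>D \<in> X\<close> show ?thesis by (rule INF_lower2)
  qed
  have "(INF C\<in>X. \<Sum>i\<in>insert i I. f i C) = (INF C\<in>X. f i C + ?g C)"
    using insert.hyps by simp
  also have "\<dots> \<le> (INF C\<in>X. INF C'\<in>X. f i C + ?g C')"
    by (intro INF_greatest le)
  \<comment> \<open>With the two variables separated, each infimum sees the other summand as a
    constant.\<close>
  also have "\<dots> = (INF C\<in>X. f i C) + (INF C'\<in>X. ?g C')"
    using assms(2) by (simp add: INF_const_add_ennreal INF_add_const_ennreal)
  also have "\<dots> \<le> (INF C\<in>X. f i C) + (\<Sum>i\<in>I. INF C\<in>X. f i C)"
  proof (intro add_left_mono insert.IH)
    show "\<exists>D\<in>X. \<forall>i\<in>I. f i D \<le> f i C \<and> f i D \<le> f i C'" if "C \<in> X" "C' \<in> X" for C C'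
      using insert.prems[OF that] by blast
  qed
  finally show ?case using insert.hyps by simp
qed

lemma open_translation_group:
  fixes V :: "'a::topological_ab_group_add set"
  assumes "open V"
  shows "open ((+) c ` V)"
proof -
  have "(+) c ` V = (+) (- c) -` V"
    by (force simp: image_iff)
  moreover have "open ((+) (- c) -` V)"
    using assms by (intro open_vimage continuous_intros)
  ultimately show ?thesis by simp
qed

text \<open>A union of translates of \<open>V\<close>, whatever \<open>C\<close> is. Openness makes
  \<open>C + V\<close> Borel, so that invariance and monotonicity of the Haar measure can be applied
  to it.\<close>

lemma open_set_plus_right:
  fixes C V :: "'a::topological_ab_group_add set"
  assumes "open V"
  shows "open (C + V)"
proof -
  have "C + V = (\<Union>c\<in>C. (+) c ` V)"
    by (auto simp: set_plus_def)
  then show ?thesis using assms by (simp add: open_UN open_translation_group)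
qed

lemma compact_set_plus:
  fixes C D :: "'a::topological_ab_group_add set"
  assumes "compact C" "compact D"
  shows "compact (C + D)"
proof -
  have "C + D = (\<lambda>(x, y). x + y) ` (C \<times> D)"
    by (auto simp: set_plus_def)
  moreover have "compact ((\<lambda>(x, y). x + y) ` (C \<times> D))"
    unfolding case_prod_beta
    using assms by (intro compact_continuous_image compact_Times continuous_intros)
  ultimately show ?thesis by simp
qed

lemma haar_measure_le_set_plus:
  fixes \<mu> :: "'a::{topological_ab_group_add,t2_space} measure"
  assumes "haar_measure \<mu>" "open V" "D \<noteq> {}"
  shows "emeasure \<mu> (C + V) \<le> emeasure \<mu> (C + D + V)"
proof -
  obtain d where d: "d \<in> D" using assms(3) by blast
  have "emeasure \<mu> (C + V) = emeasure \<mu> ((+) d ` (C + V))"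
    using assms open_set_plus_right[of V C] by (simp add: haar_measure_def)
  also have "\<dots> \<le> emeasure \<mu> (C + D + V)"
  proof (rule emeasure_mono)
    show "(+) d ` (C + V) \<subseteq> C + D + V"
    proof
      fix x assume "x \<in> (+) d ` (C + V)"
      then obtain c v where "c \<in> C" "v \<in> V" "x = (c + d) + v"
        by (auto simp: set_plus_def algebra_simps)
      with d show "x \<in> C + D + V" by (auto intro!: set_plus_intro)
    qed
    show "C + D + V \<in> sets \<mu>"
      using assms open_set_plus_right[of V "C + D"] by (simp add: haar_measure_def)
  qed
  finally show ?thesis .
qed

text \<open>The comparison is made for each \<open>V\<close> separately: the numerator stays and the
  denominator grows. The family \<open>S\<close> is kept apart from \<open>\<nu>\<close> so that one
  family can serve all summands.\<close>

lemma SUP_density_set_plus_le: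
  fixes \<mu> :: "'a::{topological_ab_group_add,t2_space} measure"
  assumes "haar_measure \<mu>" "D \<noteq> {}"
  shows "(SUP V\<in>S \<inter> bounded_opens. emeasure \<nu> V / emeasure \<mu> (C + D + V))
       \<le> (SUP V\<in>S \<inter> bounded_opens. emeasure \<nu> V / emeasure \<mu> (C + V))"
proof (rule SUP_mono)
  fix V assume V: "V \<in> S \<inter> bounded_opens"
  then have "emeasure \<mu> (C + V) \<le> emeasure \<mu> (C + D + V)"
    using assms by (intro haar_measure_le_set_plus) (auto simp: bounded_opens_def)
  then have "emeasure \<nu> V / emeasure \<mu> (C + D + V) \<le> emeasure \<nu> V / emeasure \<mu> (C + V)"
    by (simp add: divide_ennreal_def inverse_antimono_ennreal mult_left_mono)
  with V show "\<exists>W\<in>S \<inter> bounded_opens. emeasure \<nu> V / emeasure \<mu> (C + D + V)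
      \<le> emeasure \<nu> W / emeasure \<mu> (C + W)"
    by blast
qed

text \<open>The sum is described by its values on \<open>sets \<nu>\<close> rather than constructed
  as a measure, so the lemma covers both given sums and traces on disjoint unions.\<close>

lemma upper_density_sum_le:
  fixes \<mu> :: "'a::{topological_ab_group_add,t2_space} measure"
  assumes \<mu>: "haar_measure \<mu>" and "finite I"
    and sets: "\<And>i. i \<in> I \<Longrightarrow> sets (N i) = sets \<nu>"
    and sum: "\<And>V. V \<in> sets \<nu> \<Longrightarrow> emeasure \<nu> V = (\<Sum>i\<in>I. emeasure (N i) V)"
  shows "upper_density \<mu> \<nu> \<le> (\<Sum>i\<in>I. upper_density \<mu> (N i))"
proof -
  let ?X = "{C :: 'a set. compact C \<and> C \<noteq> {}}"
  let ?B = "sets \<nu> \<inter> bounded_opens"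
  let ?f = "\<lambda>i C. SUP V\<in>?B. emeasure (N i) V / emeasure \<mu> (C + V)"
  \<comment> \<open>For a fixed \<open>C\<close>, the supremum of a finite sum is at most the sum of
    the suprema.\<close>
  have "upper_density \<mu> \<nu> \<le> (INF C\<in>?X. \<Sum>i\<in>I. ?f i C)"
    unfolding upper_density_def
  proof (intro INF_mono' SUP_least)
    fix C V assume V: "V \<in> ?B"
    have "emeasure \<nu> V / emeasure \<mu> (C + V) = (\<Sum>i\<in>I. emeasure (N i) V / emeasure \<mu> (C + V))"
      using V sum by (simp add: divide_ennreal_def sum_distrib_right)
    also have "\<dots> \<le> (\<Sum>i\<in>I. ?f i C)"
      using V by (intro sum_mono SUP_upper)
    finally show "emeasure \<nu> V / emeasure \<mu> (C + V) \<le> (\<Sum>i\<in>I. ?f i C)" .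
  qed
  also have "\<dots> \<le> (\<Sum>i\<in>I. INF C\<in>?X. ?f i C)"
  proof (rule INF_sum_le_sum_INF_directed[OF \<open>finite I\<close>])
    show "?X \<noteq> {}" using compact_sing by blast
    fix C D assume CD: "C \<in> ?X" "D \<in> ?X"
    then have "C + D \<in> ?X"
      using compact_set_plus[of C D] set_plus_intro[of _ C _ D] by blast
    moreover have "?f i (C + D) \<le> ?f i C" for i
      using CD SUP_density_set_plus_le[OF \<mu>] by blast
    \<comment> \<open>The same monotonicity with the roles exchanged; commutativity of the group
      turns \<open>D + C\<close> into \<open>C + D\<close>.\<close>
    moreover have "?f i (C + D) \<le> ?f i D" for i
      using CD SUP_density_set_plus_le[OF \<mu>, where C = D and D = C] by (simp add: add.commute[of C])
    ultimately show "\<exists>E\<in>?X. \<forall>i\<in>I. ?f i E \<le> ?f i C \<and> ?f i E \<le> ?f i D"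
      by blast
  qed
  \<comment> \<open>The common sigma-algebra makes \<open>?B\<close> the range of the supremum in
    each density.\<close>
  also have "\<dots> = (\<Sum>i\<in>I. upper_density \<mu> (N i))"
    unfolding upper_density_def by (intro sum.cong refl) (simp add: sets)
  finally show ?thesis .
qed

text \<open>By finite additivity of \<open>\<nu>\<close> on the disjoint pieces
  \<open>A i \<inter> V\<close>, the trace on the union is the sum of the traces.\<close>

lemma upper_density_trace_UN_le:
  fixes \<mu> \<nu> :: "'a::{topological_ab_group_add,t2_space} measure"
  assumes "haar_measure \<mu>" "finite I"
    and A: "\<And>i. i \<in> I \<Longrightarrow> A i \<in> sets \<nu>" "disjoint_family_on A I"
  shows "upper_density \<mu> (trace_measure \<nu> (\<Union>i\<in>I. A i))
       \<le> (\<Sum>i\<in>I. upper_density \<mu> (trace_measure \<nu> (A i)))"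
proof (rule upper_density_sum_le[OF assms(1,2)])
  fix V assume "V \<in> sets (trace_measure \<nu> (\<Union>i\<in>I. A i))"
  then have V: "V \<in> sets \<nu>" by simp
  have "emeasure (trace_measure \<nu> (\<Union>i\<in>I. A i)) V = emeasure \<nu> (\<Union>i\<in>I. A i \<inter> V)"
    using A(1) V \<open>finite I\<close> by (subst emeasure_trace_measure) auto
  also have "\<dots> = (\<Sum>i\<in>I. emeasure \<nu> (A i \<inter> V))"
    using A V \<open>finite I\<close>
    by (intro sum_emeasure[symmetric]) (auto simp: disjoint_family_on_def)
  also have "\<dots> = (\<Sum>i\<in>I. emeasure (trace_measure \<nu> (A i)) V)"
    using A(1) V by (simp add: emeasure_trace_measure)
  finally show "emeasure (trace_measure \<nu> (\<Union>i\<in>I. A i)) V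
      = (\<Sum>i\<in>I. emeasure (trace_measure \<nu> (A i)) V)" .
qed simp

theorem lemma6:
  fixes \<mu> :: "'a::{topological_ab_group_add,t2_space} measure"
  assumes "locally_compact_space (euclidean :: 'a topology)"
    and "haar_measure \<mu>"
  shows "(\<forall>(S :: 'a set set) (n :: nat) (\<nu> :: nat \<Rightarrow> 'a measure).
            sigma_algebra UNIV S \<longrightarrow>
            (\<forall>j\<in>{0..n}. sets (\<nu> j) = S) \<longrightarrow>
            (\<forall>j\<in>{1..n}. locally_finite_measure (\<nu> j)) \<longrightarrow>
            (\<forall>A\<in>S. emeasure (\<nu> 0) A = (\<Sum>j=1..n. emeasure (\<nu> j) A)) \<longrightarrow>
            upper_density \<mu> (\<nu> 0) \<le> (\<Sum>j=1..n. upper_density \<mu> (\<nu> j)))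
       \<and> (\<forall>(\<nu> :: 'a measure) (n :: nat) (A :: nat \<Rightarrow> 'a set).
            space \<nu> = UNIV \<longrightarrow>
            locally_finite_measure \<nu> \<longrightarrow>
            (\<forall>j\<in>{1..n}. A j \<in> sets \<nu>) \<longrightarrow>
            disjoint_family_on A {1..n} \<longrightarrow>
            A 0 = (\<Union>j\<in>{1..n}. A j) \<longrightarrow>
            upper_density \<mu> (trace_measure \<nu> (A 0))
              \<le> (\<Sum>j=1..n. upper_density \<mu> (trace_measure \<nu> (A j))))
       \<and> (\<forall>(n :: nat) (A :: nat \<Rightarrow> 'a set).
            (\<forall>j\<in>{1..n}. A j \<in> sets borel) \<longrightarrow>
            disjoint_family_on A {1..n} \<longrightarrow>
            set_upper_density \<mu> (\<Union>j\<in>{1..n}. A j)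
              \<le> (\<Sum>j=1..n. set_upper_density \<mu> (A j)))"
proof (intro conjI allI impI)
  fix S :: "'a set set" and n :: nat and \<nu> :: "nat \<Rightarrow> 'a measure"
  assume "\<forall>j\<in>{0..n}. sets (\<nu> j) = S"
    and "\<forall>A\<in>S. emeasure (\<nu> 0) A = (\<Sum>j=1..n. emeasure (\<nu> j) A)"
  \<comment> \<open>Index 0 carries the sum and 1 to \<open>n\<close> the summands; \<open>S\<close>
    identifies \<open>sets (\<nu> j)\<close> with \<open>sets (\<nu> 0)\<close>.\<close>
  then show "upper_density \<mu> (\<nu> 0) \<le> (\<Sum>j=1..n. upper_density \<mu> (\<nu> j))"
    by (intro upper_density_sum_le[OF assms(2)]) auto
next
  fix \<nu> :: "'a measure" and n :: nat and A :: "nat \<Rightarrow> 'a set"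
  assume "\<forall>j\<in>{1..n}. A j \<in> sets \<nu>" "disjoint_family_on A {1..n}"
    and A0: "A 0 = (\<Union>j\<in>{1..n}. A j)"
  then show "upper_density \<mu> (trace_measure \<nu> (A 0))
      \<le> (\<Sum>j=1..n. upper_density \<mu> (trace_measure \<nu> (A j)))"
    unfolding A0 by (intro upper_density_trace_UN_le[OF assms(2)]) auto
next
  fix n :: nat and A :: "nat \<Rightarrow> 'a set"
  assume "\<forall>j\<in>{1..n}. A j \<in> sets borel" "disjoint_family_on A {1..n}"
  \<comment> \<open>This is the trace inequality for \<open>\<nu> = \<mu>\<close>, once Borel sets
    are known to lie in \<open>sets \<mu>\<close>.\<close>
  moreover have "sets \<mu> = sets borel"
    using assms(2) by (simp add: haar_measure_def)
  ultimately show "set_upper_density \<mu> (\<Union>j\<in>{1..n}. A j)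
      \<le> (\<Sum>j=1..n. set_upper_density \<mu> (A j))"
    unfolding set_upper_density_def by (intro upper_density_trace_UN_le[OF assms(2)]) auto
qed

end
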